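(* Let $\Phi=(\phi_n)$ be a frame for $\mathcal H$ with bounds $A_\Phi,B_\Phi$, let $\Psi=(\psi_n)$ be a sequence in $\mathcal H$ and $m=(m_n)$ a complex scalar sequence, with $m_n\ne0$, $\phi_n\ne0$, $\psi_n\neq0$ for all $n$. Assume that there exists $\mu\in[0,\frac{A_\Phi^2}{B_\Phi})$ such that $$\sum|\langle f,m_n\psi_n-\phi_n\rangle|^2\le\mu\|f\|^2,\quad\forall f\in\mathcal H.$$ Then $m\Psi=(m_n\psi_n)$ is a frame for $\mathcal H$, the multipliers $M_{\overline m,\Phi,\Psi}$ and $M_{m,\Psi,\Phi}$ are invertible on $\mathcal H$ and $$\frac{1}{B_\Phi+\sqrt{\mu B_\Phi}}\|h\|\le\|M^{-1}h\|\le\frac{1}{A_\Phi-\sqrt{\mu B_\Phi}}\|h\|,\quad\forall h\in\mathcal H,$$ $$M^{-1}=\sum_{k=0}^\infty[S_\Phi^{-1}(S_\Phi-M)]^kS_\Phi^{-1},$$ where $M$ denotes any one of $M_{\overline m,\Phi,\Psi}$ and $M_{m,\Psi,\Phi}$. As a consequence, if $m$ is semi-normalized, then $\Psi$ is also a frame for $\mathcal H$.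
   Context: $\mathcal H$ is a separable infinite-dimensional complex Hilbert space, inner product linear in the first argument; all sequences are indexed by $\mathbb N$. The multiplier is $M_{m,\Phi,\Psi}f=\sum_n m_n\langle f,\psi_n\rangle\phi_n$; it is invertible on $\mathcal H$ if the series converges for every $f\in\mathcal H$ and the resulting operator has a bounded two-sided inverse $\mathcal H\to\mathcal H$. $\overline m=(\overline{m_n})$. A frame for $\mathcal H$ with bounds $A_\Phi,B_\Phi$ is a sequence $\Phi$ with $A_\Phi>0$ and $A_\Phi\|h\|^2\le\sum|\langle h,\phi_n\rangle|^2\le B_\Phi\|h\|^2$ for all $h\in\mathcal H$; its frame operator is $S_\Phi h=\sum\langle h,\phi_n\rangle\phi_n$, which is invertible on $\mathcal H$. $m$ is semi-normalized if $0<a\le|m_n|\le b<\infty$ for all $n$ for some constants $a,b$. Infinite series of operators are understood as converging in operator norm. *)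

theory Defs
  imports "HOL-Analysis.Analysis"
begin

text \<open>
  Complex Hilbert spaces, with inner product linear in the first argument. The last axiom ties
  the norm to the inner product; as the right-hand side is a nonnegative real that vanishes only
  for \<open>x = 0\<close>, it also contains positive definiteness. Completeness comes from \<open>banach\<close>.
\<close>

class chilbert_space = banach +
  fixes scaleC :: "complex \<Rightarrow> 'a \<Rightarrow> 'a" (infixr "*\<^sub>C" 75)
    and cinner :: "'a \<Rightarrow> 'a \<Rightarrow> complex"
  assumes scaleC_add_right: "a *\<^sub>C (x + y) = a *\<^sub>C x + a *\<^sub>C y"
    and scaleC_add_left: "(a + b) *\<^sub>C x = a *\<^sub>C x + b *\<^sub>C x"
    and scaleC_scaleC: "a *\<^sub>C (b *\<^sub>C x) = (a * b) *\<^sub>C x"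
    and scaleC_of_real: "complex_of_real r *\<^sub>C x = r *\<^sub>R x"
    and cinner_commute: "cinner x y = cnj (cinner y x)"
    and cinner_add_left: "cinner (x + y) z = cinner x z + cinner y z"
    and cinner_scaleC_left: "cinner (a *\<^sub>C x) y = a * cinner x y"
    and cinner_self: "cinner x x = complex_of_real ((norm x)\<^sup>2)"

lemma vector_space_scaleC: "vector_space (scaleC :: complex \<Rightarrow> 'a \<Rightarrow> 'a::chilbert_space)"
proof
  show "1 *\<^sub>C x = x" for x :: 'a
    using scaleC_of_real[of 1 x] by simp
qed (simp_all add: scaleC_add_right scaleC_add_left scaleC_scaleC)

definition separable_infinite_dim :: "'a::chilbert_space itself \<Rightarrow> bool" where
  "separable_infinite_dim _ \<longleftrightarrow>
     (\<exists>D :: 'a set. countable D \<and> closure D = UNIV) \<and>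
     \<not> (\<exists>B :: 'a set. finite B \<and> module.span scaleC B = UNIV)"

definition bounded_clinear :: "('a::chilbert_space \<Rightarrow> 'a) \<Rightarrow> bool" where
  "bounded_clinear T \<longleftrightarrow> bounded_linear T \<and> (\<forall>c x. T (c *\<^sub>C x) = c *\<^sub>C T x)"

text \<open>
  Convergence of a series of operators in operator norm. Boundedness is demanded explicitly
  because \<open>onorm\<close> of an unbounded map is an unspecified real number.
\<close>

definition op_norm_sums ::
    "(nat \<Rightarrow> 'a::chilbert_space \<Rightarrow> 'a) \<Rightarrow> ('a \<Rightarrow> 'a) \<Rightarrow> bool" where
  "op_norm_sums T L \<longleftrightarrow>
     (\<forall>k. bounded_clinear (T k)) \<and> bounded_clinear L \<and>
     (\<lambda>N. onorm (\<lambda>h. (\<Sum>k<N. T k h) - L h)) \<longlonglongrightarrow> 0"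

definition frame_with_bounds :: "(nat \<Rightarrow> 'a::chilbert_space) \<Rightarrow> real \<Rightarrow> real \<Rightarrow> bool" where
  "frame_with_bounds \<Phi> A B \<longleftrightarrow> A > 0 \<and>
     (\<forall>h. summable (\<lambda>n. (cmod (cinner h (\<Phi> n)))\<^sup>2) \<and>
          A * (norm h)\<^sup>2 \<le> (\<Sum>n. (cmod (cinner h (\<Phi> n)))\<^sup>2) \<and>
          (\<Sum>n. (cmod (cinner h (\<Phi> n)))\<^sup>2) \<le> B * (norm h)\<^sup>2)"

definition is_frame :: "(nat \<Rightarrow> 'a::chilbert_space) \<Rightarrow> bool" where
  "is_frame \<Phi> \<longleftrightarrow> (\<exists>A B. frame_with_bounds \<Phi> A B)"

definition frame_operator :: "(nat \<Rightarrow> 'a::chilbert_space) \<Rightarrow> 'a \<Rightarrow> 'a" where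
  "frame_operator \<Phi> h = (\<Sum>n. cinner h (\<Phi> n) *\<^sub>C \<Phi> n)"

definition multiplier ::
    "(nat \<Rightarrow> complex) \<Rightarrow> (nat \<Rightarrow> 'a::chilbert_space) \<Rightarrow> (nat \<Rightarrow> 'a) \<Rightarrow> 'a \<Rightarrow> 'a" where
  "multiplier m \<Phi> \<Psi> f = (\<Sum>n. m n *\<^sub>C (cinner f (\<Psi> n) *\<^sub>C \<Phi> n))"

text \<open>
  Convergence of the defining series is part of invertibility, so the predicate is about the
  triple \<open>m, \<Phi>, \<Psi>\<close> rather than about the map \<open>multiplier m \<Phi> \<Psi>\<close>.
\<close>

definition multiplier_invertible ::
    "(nat \<Rightarrow> complex) \<Rightarrow> (nat \<Rightarrow> 'a::chilbert_space) \<Rightarrow> (nat \<Rightarrow> 'a) \<Rightarrow> bool" where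
  "multiplier_invertible m \<Phi> \<Psi> \<longleftrightarrow>
     (\<forall>f. summable (\<lambda>n. m n *\<^sub>C (cinner f (\<Psi> n) *\<^sub>C \<Phi> n))) \<and>
     (\<exists>T. bounded_clinear T \<and>
          (\<forall>h. T (multiplier m \<Phi> \<Psi> h) = h) \<and> (\<forall>h. multiplier m \<Phi> \<Psi> (T h) = h))"

definition semi_normalized :: "(nat \<Rightarrow> complex) \<Rightarrow> bool" where
  "semi_normalized m \<longleftrightarrow> (\<exists>a b. 0 < a \<and> (\<forall>n. a \<le> cmod (m n) \<and> cmod (m n) \<le> b))"

end

theory Submission
  imports Defs
begin

text \<open>
  Replacing \<open>\<Phi>\<close> by \<open>m \<Psi>\<close> in one of the two slots of \<open>S\<^sub>\<Phi>\<close> changes the operator by at most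
  \<open>sqrt (\<mu> B)\<close> in norm, since the difference is a cross operator of the Bessel sequences
  \<open>\<Phi>\<close> and \<open>m \<Psi> - \<Phi>\<close>. As \<open>norm (S\<^sub>\<Phi> h) \<ge> A norm h\<close> and \<open>sqrt (\<mu> B) < A\<close>, the multiplier is a
  small perturbation of \<open>S\<^sub>\<Phi>\<close>, and Banach's fixed point theorem and the Neumann series apply.
  The same perturbation lemma, with a multiple of the identity in place of \<open>S\<^sub>\<Phi>\<close>, shows
  that \<open>S\<^sub>\<Phi>\<close> is onto.
\<close>

section \<open>Elementary facts on complex inner products\<close>

lemma scaleC_zero_right [simp]: "c *\<^sub>C (0::'a::chilbert_space) = 0"
  using scaleC_add_right[of c 0 "0::'a"] by simp

lemma scaleC_diff_right: "c *\<^sub>C (x - y) = c *\<^sub>C x - c *\<^sub>C (y::'a::chilbert_space)"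
  using scaleC_add_right[of c "x - y" y] by (simp add: eq_diff_eq)

lemma scaleC_sum_right: "c *\<^sub>C (\<Sum>i\<in>I. f i) = (\<Sum>i\<in>I. c *\<^sub>C (f i :: 'a::chilbert_space))"
  by (induction I rule: infinite_finite_induct) (simp_all add: scaleC_add_right)

lemma scaleC_real: "r *\<^sub>R c *\<^sub>C x = c *\<^sub>C r *\<^sub>R (x::'a::chilbert_space)"
  by (simp add: scaleC_scaleC mult.commute flip: scaleC_of_real)

lemma cinner_scaleC_right: "cinner x (c *\<^sub>C y) = cnj c * cinner (x::'a::chilbert_space) y"
  by (metis cinner_commute cinner_scaleC_left complex_cnj_mult)

lemma cinner_add_right: "cinner x (y + z) = cinner x y + cinner (x::'a::chilbert_space) z"
  by (metis cinner_commute cinner_add_left complex_cnj_add)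

lemma cinner_zero_left [simp]: "cinner 0 (y::'a::chilbert_space) = 0"
  using cinner_add_left[of 0 0 y] by simp

text \<open>The class provides only real homogeneity of the norm. Complex homogeneity is read off
  from \<open>cinner\<close> on the diagonal, where \<open>c\<close> and \<open>cnj c\<close>
  combine to the squared modulus.\<close>

lemma norm_scaleC [simp]: "norm (c *\<^sub>C x) = cmod c * norm (x::'a::chilbert_space)"
proof -
  have "complex_of_real ((norm (c *\<^sub>C x))\<^sup>2) = complex_of_real ((cmod c * norm x)\<^sup>2)"
    by (simp only: cinner_self[symmetric] cinner_scaleC_left cinner_scaleC_right)
       (simp add: cinner_self power_mult_distrib complex_norm_square[of c] mult_ac del: of_real_power)
  then have "(norm (c *\<^sub>C x))\<^sup>2 = (cmod c * norm x)\<^sup>2"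
    by (simp only: of_real_eq_iff)
  then show ?thesis by simp
qed

lemma norm_add_sq:
  "(norm (x + y))\<^sup>2 = (norm x)\<^sup>2 + 2 * Re (cinner x y) + (norm (y::'a::chilbert_space))\<^sup>2"
proof -
  have "(norm (x + y))\<^sup>2 = Re (cinner (x + y) (x + y))"
    by (simp add: cinner_self)
  also have "\<dots> = Re (cinner x x) + Re (cinner x y) + Re (cinner y x) + Re (cinner y y)"
    by (simp add: cinner_add_left cinner_add_right)
  also have "Re (cinner y x) = Re (cinner x y)"
    by (subst cinner_commute) simp
  finally show ?thesis by (simp add: cinner_self)
qed

text \<open>The real part comes from the triangle inequality; the modulus by rotating \<open>x\<close>.\<close>

lemma cinner_Cauchy_Schwarz: "cmod (cinner x y) \<le> norm x * norm (y::'a::chilbert_space)"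
proof -
  have re: "Re (cinner u y) \<le> norm u * norm y" for u :: 'a
  proof -
    have "(norm (u + y))\<^sup>2 \<le> (norm u + norm y)\<^sup>2"
      by (intro power_mono norm_triangle_ineq) simp
    then show ?thesis
      by (simp add: norm_add_sq power2_sum)
  qed
  show ?thesis
  proof (cases "cinner x y = 0")
    case False
    define c where "c = cnj (sgn (cinner x y))"
    have "cmod c = 1"
      using False by (simp add: c_def norm_sgn)
    moreover have "cinner (c *\<^sub>C x) y = cmod (cinner x y)"
      using False
      by (simp add: c_def cinner_scaleC_left sgn_eq mult.commute complex_norm_square[symmetric]
          power2_eq_square)
    ultimately show ?thesis
      using re[of "c *\<^sub>C x"] by simp
  qed simp
qed

lemma bounded_linear_cinner_left: "bounded_linear (\<lambda>x. cinner x (y::'a::chilbert_space))"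
  by (rule bounded_linear_intro[where K = "norm y"])
     (simp_all add: cinner_add_left cinner_scaleC_left cinner_Cauchy_Schwarz scaleR_conv_of_real
        flip: scaleC_of_real)

lemma bounded_linear_scaleC_right: "bounded_linear (\<lambda>x. c *\<^sub>C (x::'a::chilbert_space))"
  by (rule bounded_linear_intro[where K = "cmod c"])
     (simp_all add: scaleC_add_right scaleC_real)

lemma cinner_sum_left:
  "cinner (\<Sum>i\<in>I. f i) y = (\<Sum>i\<in>I. cinner (f i) (y::'a::chilbert_space))"
  by (rule linear_sum[OF bounded_linear.linear[OF bounded_linear_cinner_left]])

section \<open>Complex-linear bounded operators\<close>

lemma bounded_clinearI:
  assumes "\<And>x y. T (x + y) = T x + T y" and "\<And>c x. T (c *\<^sub>C x) = c *\<^sub>C T x"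
    and "\<And>x. norm (T x) \<le> K * norm x"
  shows "bounded_clinear (T :: 'a::chilbert_space \<Rightarrow> 'a)"
  unfolding bounded_clinear_def
  using assms
  by (auto intro!: bounded_linear_intro[where K = K] simp: mult.commute simp flip: scaleC_of_real)

lemma bounded_clinear_imp_bounded_linear: "bounded_clinear T \<Longrightarrow> bounded_linear T"
  by (simp add: bounded_clinear_def)

lemma bounded_clinear_scaleC: "bounded_clinear T \<Longrightarrow> T (c *\<^sub>C x) = c *\<^sub>C T x"
  by (simp add: bounded_clinear_def)

lemma bounded_clinear_diff:
  assumes "bounded_clinear S" and "bounded_clinear T"
  shows "bounded_clinear (\<lambda>x. S x - T x)"
  using assms by (simp add: bounded_clinear_def bounded_linear_sub scaleC_diff_right)

lemma bounded_clinear_compose: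
  assumes "bounded_clinear S" and "bounded_clinear T"
  shows "bounded_clinear (S \<circ> T)"
  using assms bounded_linear_compose[of S T] by (simp add: bounded_clinear_def o_def)

lemma bounded_clinear_funpow:
  assumes "bounded_clinear T"
  shows "bounded_clinear (T ^^ k)"
proof (induction k)
  case 0
  then show ?case by (simp add: bounded_clinear_def id_def)
next
  case (Suc k)
  then show ?case
    unfolding funpow.simps by (rule bounded_clinear_compose[OF assms])
qed

section \<open>Operators bounded below: inverses, small perturbations, Neumann series\<close>

text \<open>The lower bound at \<open>x - y\<close> gives injectivity, and at \<open>inv T h\<close>
  the norm bound. Linearity of \<open>inv T\<close> is checked after applying the injective
  \<open>T\<close>.\<close>

lemma bounded_clinear_inv:
  fixes T :: "'a::chilbert_space \<Rightarrow> 'a"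
  assumes T: "bounded_clinear T" "surj T" and lower: "\<And>x. A * norm x \<le> norm (T x)" and "A > 0"
  shows "inj T" and "bounded_clinear (inv T)" and "norm (inv T h) \<le> 1 / A * norm h"
proof -
  interpret T: bounded_linear T
    using T(1) by (rule bounded_clinear_imp_bounded_linear)
  show inj: "inj T"
  proof (rule injI)
    fix x y assume "T x = T y"
    then have "A * norm (x - y) \<le> 0"
      using lower[of "x - y"] by (simp add: T.diff)
    with \<open>A > 0\<close> show "x = y"
      by (simp add: mult_le_0_iff)
  qed
  have T_inv: "T (inv T x) = x" for x
    by (rule surj_f_inv_f[OF T(2)])
  show bound: "norm (inv T h) \<le> 1 / A * norm h" for h
    using lower[of "inv T h"] \<open>A > 0\<close> by (simp add: T_inv field_simps)
  show "bounded_clinear (inv T)"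
  proof (rule bounded_clinearI[where K = "1 / A"])
    show "inv T (x + y) = inv T x + inv T y" for x y
      by (rule injD[OF inj]) (simp add: T_inv T.add)
    show "inv T (c *\<^sub>C x) = c *\<^sub>C inv T x" for c x
      by (rule injD[OF inj]) (simp add: T_inv bounded_clinear_scaleC[OF T(1)])
  qed (rule bound)
qed

text \<open>A solution of \<open>M x = y\<close> is a fixed point of
  \<open>\<lambda>x. inv S (y + (S x - M x))\<close>. As \<open>inv S\<close> has norm at most
  \<open>1 / A\<close>, this map contracts with constant \<open>c / A < 1\<close>, and the space is
  complete.\<close>

lemma surj_perturbation:
  fixes S M :: "'a::chilbert_space \<Rightarrow> 'a"
  assumes S: "bounded_clinear S" "surj S" and lower: "\<And>x. A * norm x \<le> norm (S x)"
    and M: "bounded_clinear M" and close: "\<And>x. norm (S x - M x) \<le> c * norm x"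
    and c: "0 \<le> c" "c < A"
  shows "surj M"
proof (rule surjI)
  have "A > 0" using c by simp
  note inv_S = bounded_clinear_inv[OF S lower \<open>A > 0\<close>]
  interpret D: bounded_linear "\<lambda>x. S x - M x"
    using bounded_clinear_diff[OF S(1) M] by (rule bounded_clinear_imp_bounded_linear)
  interpret I: bounded_linear "inv S"
    using inv_S(2) by (rule bounded_clinear_imp_bounded_linear)
  fix y
  define f where "f x = inv S (y + (S x - M x))" for x
  have "\<exists>!x. f x = x"
  proof (rule banach_fix_type[where c = "c / A"])
    show "\<forall>u v. dist (f u) (f v) \<le> c / A * dist u v"
    proof (intro allI)
      fix u v
      have "f u - f v = inv S (S (u - v) - M (u - v))"
        by (simp add: f_def flip: I.diff) (simp add: D.diff)
      also have "norm \<dots> \<le> 1 / A * norm (S (u - v) - M (u - v))"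
        by (rule inv_S(3))
      also have "\<dots> \<le> 1 / A * (c * norm (u - v))"
        using \<open>A > 0\<close> by (intro mult_left_mono close) simp
      finally show "dist (f u) (f v) \<le> c / A * dist u v" by (simp add: dist_norm)
    qed
  qed (use c in simp_all)
  then obtain x where "f x = x" by blast
  \<comment> \<open>Applying \<open>S\<close> removes \<open>inv S\<close>; cancelling
    \<open>S x\<close> then leaves \<open>M x = y\<close>.\<close>
  then have "S x = y + (S x - M x)"
    unfolding f_def by (metis surj_f_inv_f[OF S(2)])
  then have "\<exists>x. M x = y"
    by (intro exI[of _ x]) (simp add: algebra_simps)
  then show "M (SOME x. M x = y) = y"
    by (rule someI_ex)
qed

text \<open>The iterated map is the identity minus \<open>inv S \<circ> M\<close>. Hence
  \<open>inv S\<close> is this identity-minus-contraction defect applied after \<open>inv M\<close>: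
  the partial sums telescope, and the remainder decays like \<open>(c / A) ^ N\<close>.\<close>

lemma Neumann_series_inv:
  fixes S M :: "'a::chilbert_space \<Rightarrow> 'a"
  assumes S: "bounded_clinear S" "surj S" and lower: "\<And>x. A * norm x \<le> norm (S x)"
    and M: "bounded_clinear M" and close: "\<And>x. norm (S x - M x) \<le> c * norm x"
    and c: "0 \<le> c" "c < A"
  shows "inj M" and "surj M" and "bounded_clinear (inv M)"
    and "norm (inv M h) \<le> 1 / (A - c) * norm h"
    and "op_norm_sums (\<lambda>k. ((\<lambda>f. inv S (S f - M f)) ^^ k) \<circ> inv S) (inv M)"
proof -
  have "A > 0" "A - c > 0" using c by simp_all
  note inv_S = bounded_clinear_inv[OF S lower \<open>A > 0\<close>]
  show surj_M: "surj M"
    by (rule surj_perturbation[OF assms])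
  \<comment> \<open>Together with surjectivity, this lower bound yields the constant
    \<open>1 / (A - c)\<close> for \<open>inv M\<close> directly, without summing the
    series.\<close>
  have lower_M: "(A - c) * norm x \<le> norm (M x)" for x
    using lower[of x] close[of x] norm_triangle_sub[of "S x" "M x"] by (simp add: algebra_simps)
  note inv_M = bounded_clinear_inv[OF M surj_M lower_M \<open>A - c > 0\<close>]
  show "inj M" "bounded_clinear (inv M)" "norm (inv M h) \<le> 1 / (A - c) * norm h"
    by (rule inv_M)+
  have M_inv: "M (inv M x) = x" for x
    by (rule surj_f_inv_f[OF surj_M])
  define T where "T f = inv S (S f - M f)" for f
  have T: "bounded_clinear T"
    unfolding T_def using bounded_clinear_compose[OF inv_S(2) bounded_clinear_diff[OF S(1) M]]
    by (simp add: o_def)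
  interpret I: bounded_linear "inv S"
    using inv_S(2) by (rule bounded_clinear_imp_bounded_linear)
  have norm_T: "norm ((T ^^ k) x) \<le> (c / A) ^ k * norm x" for k x
  proof (induction k)
    case (Suc k)
    have "norm ((T ^^ Suc k) x) \<le> 1 / A * norm (S ((T ^^ k) x) - M ((T ^^ k) x))"
      unfolding funpow.simps o_apply T_def[of "(T ^^ k) x"] by (rule inv_S(3))
    also have "\<dots> \<le> 1 / A * (c * norm ((T ^^ k) x))"
      using \<open>A > 0\<close> by (intro mult_left_mono close) simp
    also have "\<dots> \<le> 1 / A * (c * ((c / A) ^ k * norm x))"
      using \<open>A > 0\<close> c(1) by (intro mult_left_mono Suc) simp_all
    finally show ?case by simp
  qed simp
  \<comment> \<open>With \<open>g = inv M h\<close>, the map \<open>T\<close> sends \<open>g\<close>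
    to \<open>g - inv S (M g)\<close>, which is \<open>g - inv S h\<close>.\<close>
  have inv_S_eq: "inv S h = inv M h - T (inv M h)" for h
    by (simp add: T_def I.diff M_inv inv_f_f[OF inv_S(1)])
  \<comment> \<open>Exact telescoping: the summand with index \<open>N\<close> turns the remainder
    at \<open>N\<close> into the one at \<open>Suc N\<close>. For \<open>N = 0\<close> the sum is
    empty and the remainder is \<open>- inv M h\<close>.\<close>
  have remainder: "(\<Sum>k<N. (T ^^ k) (inv S h)) - inv M h = - (T ^^ N) (inv M h)" for N h
  proof (induction N)
    case (Suc N)
    interpret P: bounded_linear "T ^^ N"
      using bounded_clinear_funpow[OF T] by (rule bounded_clinear_imp_bounded_linear)
    have "(T ^^ N) (inv S h) = (T ^^ N) (inv M h) - (T ^^ Suc N) (inv M h)"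
      by (simp add: inv_S_eq P.diff funpow_swap1)
    with Suc show ?case unfolding sum.lessThan_Suc by (metis (no_types, lifting) add_diff_eq add_diff_cancel_left' diff_add_eq diff_diff_eq2 uminus_add_conv_diff)
  qed simp
  have onorm_le: "onorm (\<lambda>h. (\<Sum>k<N. ((T ^^ k) \<circ> inv S) h) - inv M h) \<le> (c / A) ^ N * (1 / (A - c))"
    for N
  proof (rule onorm_bound)
    show "0 \<le> (c / A) ^ N * (1 / (A - c))"
      using c by simp
    fix h
    have "norm ((\<Sum>k<N. ((T ^^ k) \<circ> inv S) h) - inv M h) = norm ((T ^^ N) (inv M h))"
      by (simp add: remainder)
    also have "\<dots> \<le> (c / A) ^ N * norm (inv M h)"
      by (rule norm_T)
    also have "\<dots> \<le> (c / A) ^ N * (1 / (A - c) * norm h)"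
      using c by (intro mult_left_mono inv_M(3)) simp
    finally show "norm ((\<Sum>k<N. ((T ^^ k) \<circ> inv S) h) - inv M h) \<le> (c / A) ^ N * (1 / (A - c)) * norm h"
      by simp
  qed
  \<comment> \<open>The lower half of the sandwich below, \<open>onorm\<close> being nonnegative, is
    drawn from boundedness of these maps.\<close>
  have blin: "bounded_linear (\<lambda>h. (\<Sum>k<N. ((T ^^ k) \<circ> inv S) h) - inv M h)" for N
    by (intro bounded_linear_sub bounded_linear_sum bounded_clinear_imp_bounded_linear
        bounded_clinear_compose bounded_clinear_funpow T inv_S inv_M)
  have "(\<lambda>N. onorm (\<lambda>h. (\<Sum>k<N. ((T ^^ k) \<circ> inv S) h) - inv M h)) \<longlonglongrightarrow> 0"
  proof (rule tendsto_sandwich[OF _ _ tendsto_const])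
    show "\<forall>\<^sub>F N in sequentially. 0 \<le> onorm (\<lambda>h. (\<Sum>k<N. ((T ^^ k) \<circ> inv S) h) - inv M h)"
      by (intro always_eventually allI onorm_pos_le blin)
    show "\<forall>\<^sub>F N in sequentially. onorm (\<lambda>h. (\<Sum>k<N. ((T ^^ k) \<circ> inv S) h) - inv M h)
        \<le> (c / A) ^ N * (1 / (A - c))"
      by (intro always_eventually allI onorm_le)
    show "(\<lambda>N. (c / A) ^ N * (1 / (A - c))) \<longlonglongrightarrow> 0"
      using c by (intro tendsto_mult_left_zero LIMSEQ_power_zero) simp
  qed
  then have "op_norm_sums (\<lambda>k. (T ^^ k) \<circ> inv S) (inv M)"
    unfolding op_norm_sums_def
    by (intro conjI allI bounded_clinear_compose bounded_clinear_funpow T inv_S inv_M)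
  then show "op_norm_sums (\<lambda>k. ((\<lambda>f. inv S (S f - M f)) ^^ k) \<circ> inv S) (inv M)"
    by (simp add: T_def[abs_def])
qed

section \<open>Bessel sequences\<close>

text \<open>The upper half of the frame condition. Nonnegativity of \<open>b\<close> is stated
  because in the zero space it would not follow from the inequality.\<close>

definition bessel :: "(nat \<Rightarrow> 'a::chilbert_space) \<Rightarrow> real \<Rightarrow> bool" where
  "bessel V b \<longleftrightarrow> 0 \<le> b \<and> (\<forall>h. summable (\<lambda>n. (cmod (cinner h (V n)))\<^sup>2) \<and>
     (\<Sum>n. (cmod (cinner h (V n)))\<^sup>2) \<le> b * (norm h)\<^sup>2)"

text \<open>Duality: pair the sum \<open>g\<close> with itself, apply Cauchy-Schwarz to the
  coefficients, bound the factor \<open>cinner g (V n)\<close> by the Bessel inequality for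
  \<open>g\<close>, and cancel \<open>(norm g)\<^sup>2\<close>.\<close>

lemma bessel_finite_synthesis:
  assumes "bessel V b" and "finite I"
  shows "(norm (\<Sum>n\<in>I. c n *\<^sub>C V n))\<^sup>2 \<le> b * (\<Sum>n\<in>I. (cmod (c n))\<^sup>2)"
proof -
  define g where "g = (\<Sum>n\<in>I. c n *\<^sub>C V n)"
  define C where "C = (\<Sum>n\<in>I. (cmod (c n))\<^sup>2)"
  have "(norm g)\<^sup>2 = cmod (cinner g g)"
    by (simp add: cinner_self del: of_real_power)
  also have "cinner g g = (\<Sum>n\<in>I. c n * cinner (V n) g)"
    by (subst (1) g_def) (simp add: cinner_sum_left cinner_scaleC_left)
  also have "cmod \<dots> \<le> (\<Sum>n\<in>I. cmod (c n) * cmod (cinner g (V n)))"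
    by (rule sum_norm_le) (subst cinner_commute, simp add: norm_mult)
  finally have "((norm g)\<^sup>2)\<^sup>2 \<le> (\<Sum>n\<in>I. cmod (c n) * cmod (cinner g (V n)))\<^sup>2"
    by (rule power_mono) simp
  also have "\<dots> \<le> C * (\<Sum>n\<in>I. (cmod (cinner g (V n)))\<^sup>2)"
    unfolding C_def by (rule Cauchy_Schwarz_ineq_sum)
  also have "\<dots> \<le> C * (b * (norm g)\<^sup>2)"
  proof (rule mult_left_mono)
    have "(\<Sum>n\<in>I. (cmod (cinner g (V n)))\<^sup>2) \<le> (\<Sum>n. (cmod (cinner g (V n)))\<^sup>2)"
      using assms by (intro sum_le_suminf) (auto simp: bessel_def)
    also have "\<dots> \<le> b * (norm g)\<^sup>2"
      using assms by (simp add: bessel_def)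
    finally show "(\<Sum>n\<in>I. (cmod (cinner g (V n)))\<^sup>2) \<le> b * (norm g)\<^sup>2" .
  qed (simp add: C_def sum_nonneg)
  finally have "(norm g)\<^sup>2 * (norm g)\<^sup>2 \<le> (b * C) * (norm g)\<^sup>2"
    by (simp add: power2_eq_square mult_ac)
  moreover have "0 \<le> b * C"
    using assms by (simp add: C_def bessel_def sum_nonneg)
  ultimately have "(norm g)\<^sup>2 \<le> b * C"
    by (cases "g = 0") (simp_all only: mult_le_cancel_right zero_less_power2, simp_all)
  then show ?thesis by (simp add: g_def C_def)
qed

text \<open>The finite bound on blocks of indices makes the partial sums Cauchy; on initial segments
  it passes to the limit.\<close>

lemma bessel_synthesis:
  assumes V: "bessel V b" and c: "summable (\<lambda>n. (cmod (c n))\<^sup>2)"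
  shows "summable (\<lambda>n. c n *\<^sub>C V n)"
    and "(norm (\<Sum>n. c n *\<^sub>C V n))\<^sup>2 \<le> b * (\<Sum>n. (cmod (c n))\<^sup>2)"
proof -
  have b: "0 \<le> b" using V by (simp add: bessel_def)
  show summ: "summable (\<lambda>n. c n *\<^sub>C V n)"
    unfolding summable_Cauchy
  proof (intro allI impI)
    fix e :: real assume "e > 0"
    \<comment> \<open>Dividing by \<open>b + 1\<close> rather than \<open>b\<close> covers the case
      \<open>b = 0\<close>.\<close>
    then have "e\<^sup>2 / (b + 1) > 0" using b by simp
    then obtain N where N: "\<And>m n. m \<ge> N \<Longrightarrow> norm (\<Sum>k = m..<n. (cmod (c k))\<^sup>2) < e\<^sup>2 / (b + 1)"
      using c unfolding summable_Cauchy by blast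
    have "norm (\<Sum>k = m..<n. c k *\<^sub>C V k) < e" if "m \<ge> N" for m n
    proof -
      have s: "(\<Sum>k = m..<n. (cmod (c k))\<^sup>2) < e\<^sup>2 / (b + 1)"
        using N[OF that, of n] by (simp add: sum_nonneg)
      have "(norm (\<Sum>k = m..<n. c k *\<^sub>C V k))\<^sup>2 \<le> b * (\<Sum>k = m..<n. (cmod (c k))\<^sup>2)"
        by (rule bessel_finite_synthesis[OF V]) simp
      also have "\<dots> \<le> (b + 1) * (\<Sum>k = m..<n. (cmod (c k))\<^sup>2)"
        by (intro mult_right_mono sum_nonneg) simp_all
      also have "\<dots> < e\<^sup>2"
        using s b by (simp add: field_simps)
      finally show ?thesis
        using \<open>e > 0\<close> by (simp add: power_less_imp_less_base)
    qed
    then show "\<exists>N. \<forall>m\<ge>N. \<forall>n. norm (\<Sum>k = m..<n. c k *\<^sub>C V k) < e" by blast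
  qed
  show "(norm (\<Sum>n. c n *\<^sub>C V n))\<^sup>2 \<le> b * (\<Sum>n. (cmod (c n))\<^sup>2)"
  proof (rule LIMSEQ_le)
    show "(\<lambda>N. (norm (\<Sum>n<N. c n *\<^sub>C V n))\<^sup>2) \<longlonglongrightarrow> (norm (\<Sum>n. c n *\<^sub>C V n))\<^sup>2"
      by (intro tendsto_intros summable_LIMSEQ summ)
    show "(\<lambda>N. b * (\<Sum>n<N. (cmod (c n))\<^sup>2)) \<longlonglongrightarrow> b * (\<Sum>n. (cmod (c n))\<^sup>2)"
      by (intro tendsto_intros summable_LIMSEQ c)
  qed (use bessel_finite_synthesis[OF V] in auto)
qed

section \<open>Cross operators of two Bessel sequences\<close>

text \<open>Analysis with \<open>U\<close> followed by synthesis with \<open>V\<close>. The frame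
  operator and, once \<open>m\<close> is absorbed into \<open>\<Psi>\<close>, both multipliers have
  this form.\<close>

definition cross :: "(nat \<Rightarrow> 'a::chilbert_space) \<Rightarrow> (nat \<Rightarrow> 'a) \<Rightarrow> 'a \<Rightarrow> 'a" where
  "cross U V f = (\<Sum>n. cinner f (U n) *\<^sub>C V n)"

lemma summable_cross:
  assumes "bessel U a" and "bessel V b"
  shows "summable (\<lambda>n. cinner f (U n) *\<^sub>C V n)"
  using assms(1) by (intro bessel_synthesis(1)[OF assms(2)]) (auto simp: bessel_def)

text \<open>Keeping the coefficient sum on the right lets a lower bound on \<open>cross U V\<close>
  be turned into a lower frame bound for \<open>U\<close>.\<close>

lemma norm_cross_sq_le:
  assumes "bessel U a" and "bessel V b"
  shows "(norm (cross U V f))\<^sup>2 \<le> b * (\<Sum>n. (cmod (cinner f (U n)))\<^sup>2)"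
  unfolding cross_def using assms(1) by (intro bessel_synthesis(2)[OF assms(2)]) (auto simp: bessel_def)

lemma norm_cross_le:
  assumes U: "bessel U a" and V: "bessel V b"
  shows "norm (cross U V f) \<le> sqrt (a * b) * norm f"
proof -
  have "b * (\<Sum>n. (cmod (cinner f (U n)))\<^sup>2) \<le> b * (a * (norm f)\<^sup>2)"
    using U V by (intro mult_left_mono) (simp_all add: bessel_def)
  with norm_cross_sq_le[OF U V, of f]
  have "(norm (cross U V f))\<^sup>2 \<le> b * (a * (norm f)\<^sup>2)"
    by (rule order_trans)
  then have "norm (cross U V f) \<le> sqrt (b * (a * (norm f)\<^sup>2))"
    by (rule real_le_rsqrt)
  then show ?thesis by (simp add: real_sqrt_mult mult_ac)
qed

lemma bounded_clinear_cross:
  assumes U: "bessel U a" and V: "bessel V b"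
  shows "bounded_clinear (cross U V)"
proof (rule bounded_clinearI)
  note s = summable_cross[OF U V]
  show "cross U V (x + y) = cross U V x + cross U V y" for x y
    by (simp add: cross_def cinner_add_left scaleC_add_left suminf_add[OF s s])
  show "cross U V (c *\<^sub>C x) = c *\<^sub>C cross U V x" for c x
    by (simp add: cross_def cinner_scaleC_left scaleC_scaleC[symmetric]
        bounded_linear.suminf[OF bounded_linear_scaleC_right s])
qed (rule norm_cross_le[OF U V])

text \<open>Identifies the frame sum with the quadratic form of the frame operator, so that the
  lower frame bound becomes coercivity.\<close>

lemma cinner_cross_self:
  assumes V: "bessel V b"
  shows "cinner (cross V V f) f = complex_of_real (\<Sum>n. (cmod (cinner f (V n)))\<^sup>2)"
proof -
  have "cinner (cross V V f) f = (\<Sum>n. cinner (cinner f (V n) *\<^sub>C V n) f)"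
    unfolding cross_def
    by (rule bounded_linear.suminf[OF bounded_linear_cinner_left summable_cross[OF V V]])
  also have "\<dots> = (\<Sum>n. complex_of_real ((cmod (cinner f (V n)))\<^sup>2))"
    by (rule arg_cong[where f = suminf], rule ext)
       (simp add: cinner_scaleC_left complex_norm_square cinner_commute[of "V _" f] del: of_real_power)
  also have "\<dots> = complex_of_real (\<Sum>n. (cmod (cinner f (V n)))\<^sup>2)"
    using V by (intro suminf_of_real[symmetric]) (simp add: bessel_def)
  finally show ?thesis .
qed

text \<open>Termwise \<open>(s + t)\<^sup>2 \<le> 2 * s\<^sup>2 + 2 * t\<^sup>2\<close>. The
  constant is crude, but it serves only to show that \<open>m \<Psi>\<close> has some Bessel
  bound.\<close>

lemma bessel_add:
  assumes U: "bessel U a" and V: "bessel V b"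
  shows "bessel (\<lambda>n. U n + V n) (2 * a + 2 * b)"
  unfolding bessel_def
proof (intro conjI allI)
  fix h
  let ?u = "\<lambda>n. (cmod (cinner h (U n)))\<^sup>2" and ?v = "\<lambda>n. (cmod (cinner h (V n)))\<^sup>2"
  have le: "(cmod (cinner h (U n + V n)))\<^sup>2 \<le> 2 * ?u n + 2 * ?v n" for n
  proof -
    have "(cmod (cinner h (U n + V n)))\<^sup>2 \<le> (cmod (cinner h (U n)) + cmod (cinner h (V n)))\<^sup>2"
      by (intro power_mono) (simp_all add: cinner_add_right norm_triangle_ineq)
    also have "\<dots> \<le> 2 * ?u n + 2 * ?v n"
      using sum_squares_bound[of "cmod (cinner h (U n))" "cmod (cinner h (V n))"]
      by (simp add: power2_sum)
    finally show ?thesis .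
  qed
  have su: "summable ?u" and sv: "summable ?v"
    using U V by (auto simp: bessel_def)
  have s2: "summable (\<lambda>n. 2 * ?u n + 2 * ?v n)"
    by (intro summable_add summable_mult su sv)
  show s: "summable (\<lambda>n. (cmod (cinner h (U n + V n)))\<^sup>2)"
    by (rule summable_comparison_test'[OF s2]) (simp add: le)
  have "(\<Sum>n. (cmod (cinner h (U n + V n)))\<^sup>2) \<le> (\<Sum>n. 2 * ?u n + 2 * ?v n)"
    by (rule suminf_le[OF le s s2])
  also have "\<dots> = 2 * suminf ?u + 2 * suminf ?v"
    by (simp add: suminf_add[symmetric] suminf_mult summable_mult su sv)
  also have "\<dots> \<le> 2 * (a * (norm h)\<^sup>2) + 2 * (b * (norm h)\<^sup>2)"
    using U V by (intro add_mono mult_left_mono) (auto simp: bessel_def)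
  finally show "(\<Sum>n. (cmod (cinner h (U n + V n)))\<^sup>2) \<le> (2 * a + 2 * b) * (norm h)\<^sup>2"
    by (simp add: algebra_simps)
qed (use U V in \<open>simp add: bessel_def\<close>)

section \<open>Frames\<close>

text \<open>The zero space is spanned by the empty set, hence finite-dimensional. The nonzero vector
  serves to compare the frame bounds.\<close>

lemma nontrivial_if_separable_infinite_dim:
  assumes "separable_infinite_dim TYPE('a::chilbert_space)"
  shows "\<exists>x :: 'a. x \<noteq> 0"
proof (rule ccontr)
  assume "\<nexists>x :: 'a. x \<noteq> 0"
  then have "module.span scaleC {} = (UNIV :: 'a set)"
    using module.span_empty[of "scaleC :: _ \<Rightarrow> 'a \<Rightarrow> 'a"] vector_space_scaleC
    by (auto simp: module_iff_vector_space)
  then show False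
    using assms by (auto simp: separable_infinite_dim_def)
qed

text \<open>Both frame inequalities are compared at \<open>x\<close>; in the zero space
  \<open>A\<close> and \<open>B\<close> would be unrelated.\<close>

lemma frame_bounds_le:
  assumes "frame_with_bounds (\<Phi> :: nat \<Rightarrow> 'a::chilbert_space) A B" and "x \<noteq> (0::'a)"
  shows "A \<le> B"
proof -
  have "A * (norm x)\<^sup>2 \<le> B * (norm x)\<^sup>2"
    using assms(1) unfolding frame_with_bounds_def by (meson order_trans)
  with assms(2) show ?thesis by simp
qed

text \<open>Coercivity and Cauchy-Schwarz give the lower norm bound. Surjectivity is a Lax-Milgram
  argument: coercivity places the operator close to \<open>L\<close> times the identity.\<close>

lemma frame_operator_bounds_surj:
  assumes \<Phi>: "frame_with_bounds \<Phi> A B" and "A \<le> B"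
  shows "bessel \<Phi> B" and "bounded_clinear (frame_operator \<Phi>)" and "surj (frame_operator \<Phi>)"
    and "A * norm h \<le> norm (frame_operator \<Phi> h)" and "norm (frame_operator \<Phi> h) \<le> B * norm h"
proof -
  have "A > 0" "B > 0"
    using assms by (auto simp: frame_with_bounds_def)
  show bes: "bessel \<Phi> B"
    using \<Phi> \<open>B > 0\<close> by (simp add: bessel_def frame_with_bounds_def)
  have S_eq: "frame_operator \<Phi> = cross \<Phi> \<Phi>"
    by (rule ext) (simp add: frame_operator_def cross_def)
  show S: "bounded_clinear (frame_operator \<Phi>)"
    unfolding S_eq by (rule bounded_clinear_cross[OF bes bes])
  show upper: "norm (frame_operator \<Phi> h) \<le> B * norm h" for h
    using norm_cross_le[OF bes bes, of h] \<open>B > 0\<close> by (simp add: S_eq real_sqrt_mult)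
  have coercive: "A * (norm h)\<^sup>2 \<le> Re (cinner (frame_operator \<Phi> h) h)" for h
    using \<Phi> by (simp add: S_eq cinner_cross_self[OF bes] frame_with_bounds_def)
  show "A * norm h \<le> norm (frame_operator \<Phi> h)"
  proof (cases "h = 0")
    case False
    have "A * (norm h)\<^sup>2 \<le> norm (frame_operator \<Phi> h) * norm h"
      using coercive[of h] complex_Re_le_cmod cinner_Cauchy_Schwarz by (meson order_trans)
    with False show ?thesis by (simp add: power2_eq_square)
  qed simp
  text \<open>The scalar \<open>B\<^sup>2 / A\<close> minimises the contraction constant that coercivity gives.\<close>
  define L where "L = B\<^sup>2 / A"
  \<comment> \<open>This makes the radicand \<open>L\<^sup>2 - B\<^sup>2\<close> nonnegative; its
    root is below \<open>L\<close> because \<open>B > 0\<close>.\<close>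
  have "B \<le> L"
    using \<open>A \<le> B\<close> \<open>A > 0\<close> by (simp add: L_def field_simps power2_eq_square)
  then have "L > 0" using \<open>B > 0\<close> by simp
  show "surj (frame_operator \<Phi>)"
  proof (rule surj_perturbation[where A = L and c = "sqrt (L\<^sup>2 - B\<^sup>2)", OF _ _ _ S])
    show "bounded_clinear (\<lambda>x. L *\<^sub>R x :: 'a)"
      by (rule bounded_clinearI[where K = L])
         (use \<open>L > 0\<close> in \<open>simp_all add: scaleR_add_right scaleC_real\<close>)
    show "surj (\<lambda>x. L *\<^sub>R x :: 'a)"
      by (rule surjI[where f = "\<lambda>x. (1 / L) *\<^sub>R x"]) (use \<open>L > 0\<close> in simp)
    show "L * norm x \<le> norm (L *\<^sub>R x)" for x :: 'a
      using \<open>L > 0\<close> by simp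
    show "0 \<le> sqrt (L\<^sup>2 - B\<^sup>2)"
      using \<open>B \<le> L\<close> \<open>B > 0\<close> by (simp add: power_mono)
    show "sqrt (L\<^sup>2 - B\<^sup>2) < L"
      using \<open>L > 0\<close> \<open>B > 0\<close> by (simp add: real_less_lsqrt)
    fix x
    let ?S = "frame_operator \<Phi> x"
    have neg: "cinner (- ?S) (L *\<^sub>R x) = - (L * cinner ?S x)"
      by (simp add: cinner_scaleC_right linear_neg[OF bounded_linear.linear[OF bounded_linear_cinner_left]]
          flip: scaleC_of_real)
    have "(norm (L *\<^sub>R x - ?S))\<^sup>2 = (norm (- ?S + L *\<^sub>R x))\<^sup>2"
      by simp
    also have "\<dots> = (norm ?S)\<^sup>2 - 2 * (L * Re (cinner ?S x)) + L\<^sup>2 * (norm x)\<^sup>2"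
      unfolding norm_add_sq neg by (simp add: power_mult_distrib)
    also have "\<dots> \<le> (B * norm x)\<^sup>2 - 2 * (L * (A * (norm x)\<^sup>2)) + L\<^sup>2 * (norm x)\<^sup>2"
      using coercive[of x] upper[of x] \<open>L > 0\<close>
      by (intro add_right_mono diff_mono power_mono mult_left_mono) simp_all
    \<comment> \<open>The choice of \<open>L\<close> gives \<open>L * A = B\<^sup>2\<close>, so the
      coefficient \<open>B\<^sup>2 - 2 * L * A + L\<^sup>2\<close> collapses.\<close>
    also have "\<dots> = (L\<^sup>2 - B\<^sup>2) * (norm x)\<^sup>2"
      using \<open>A > 0\<close> by (simp add: L_def power_mult_distrib field_simps)
    finally have "norm (L *\<^sub>R x - ?S) \<le> sqrt ((L\<^sup>2 - B\<^sup>2) * (norm x)\<^sup>2)"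
      by (rule real_le_rsqrt)
    then show "norm (L *\<^sub>R x - ?S) \<le> sqrt (L\<^sup>2 - B\<^sup>2) * norm x"
      by (simp add: real_sqrt_mult)
  qed
qed

text \<open>Only the distance of \<open>M\<close> from the frame operator enters, so one statement
  serves both multipliers.\<close>

lemma frame_perturbation:
  fixes \<Phi> :: "nat \<Rightarrow> 'a::chilbert_space"
  assumes \<Phi>: "frame_with_bounds \<Phi> A B" and "A \<le> B"
    and M: "bounded_clinear M"
    and close: "\<And>h. norm (frame_operator \<Phi> h - M h) \<le> c * norm h"
    and c: "0 \<le> c" "c < A"
  shows "\<exists>T. bounded_clinear T \<and> (\<forall>h. T (M h) = h) \<and> (\<forall>h. M (T h) = h)"
    and "(\<forall>h. 1 / (B + c) * norm h \<le> norm (inv M h) \<and> norm (inv M h) \<le> 1 / (A - c) * norm h) \<and>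
       op_norm_sums
         (\<lambda>k. ((\<lambda>f. inv (frame_operator \<Phi>) (frame_operator \<Phi> f - M f)) ^^ k)
                 \<circ> inv (frame_operator \<Phi>))
         (inv M)"
proof -
  note S = frame_operator_bounds_surj[OF \<Phi> \<open>A \<le> B\<close>]
  note N = Neumann_series_inv[OF S(2,3,4) M close c]
  show "\<exists>T. bounded_clinear T \<and> (\<forall>h. T (M h) = h) \<and> (\<forall>h. M (T h) = h)"
    using N(1-3) by (intro exI[of _ "inv M"]) (simp add: surj_f_inv_f)
  have "1 / (B + c) * norm h \<le> norm (inv M h)" for h
  proof -
    let ?g = "inv M h"
    \<comment> \<open>The lower bound on \<open>inv M\<close> is the upper bound
      \<open>B + c\<close> on \<open>M\<close>, evaluated at \<open>inv M h\<close>.\<close>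
    have "norm (M ?g) \<le> norm (frame_operator \<Phi> ?g) + norm (frame_operator \<Phi> ?g - M ?g)"
      using norm_triangle_ineq4[of "frame_operator \<Phi> ?g" "frame_operator \<Phi> ?g - M ?g"] by simp
    also have "\<dots> \<le> (B + c) * norm ?g"
      using S(5)[of ?g] close[of ?g] by (simp add: algebra_simps)
    finally show ?thesis
      using N(2) c \<open>A \<le> B\<close> by (simp add: surj_f_inv_f field_simps)
  qed
  with N(4,5)
  show "(\<forall>h. 1 / (B + c) * norm h \<le> norm (inv M h) \<and> norm (inv M h) \<le> 1 / (A - c) * norm h) \<and>
       op_norm_sums
         (\<lambda>k. ((\<lambda>f. inv (frame_operator \<Phi>) (frame_operator \<Phi> f - M f)) ^^ k)
                 \<circ> inv (frame_operator \<Phi>))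
         (inv M)"
    by blast
qed

text \<open>The two frame sums are comparable term by term, with factors \<open>a\<^sup>2\<close>
  and \<open>b\<^sup>2\<close>.\<close>

lemma is_frame_unscale:
  assumes frame: "is_frame (\<lambda>n. m n *\<^sub>C \<Psi> n)" and "semi_normalized m"
  shows "is_frame \<Psi>"
proof -
  obtain a b where a: "0 < a" and am: "\<And>n. a \<le> cmod (m n)" and bm: "\<And>n. cmod (m n) \<le> b"
    using assms(2) by (auto simp: semi_normalized_def)
  have "b > 0" using a am[of 0] bm[of 0] by linarith
  obtain A B where X: "frame_with_bounds (\<lambda>n. m n *\<^sub>C \<Psi> n) A B"
    using frame by (auto simp: is_frame_def)
  have "frame_with_bounds \<Psi> (A / b\<^sup>2) (B / a\<^sup>2)"
    unfolding frame_with_bounds_def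
  proof (intro conjI allI)
    show "0 < A / b\<^sup>2" using X \<open>b > 0\<close> by (simp add: frame_with_bounds_def)
    fix h
    let ?x = "\<lambda>n. (cmod (cinner h (m n *\<^sub>C \<Psi> n)))\<^sup>2" and ?p = "\<lambda>n. (cmod (cinner h (\<Psi> n)))\<^sup>2"
    have x: "?x n = (cmod (m n))\<^sup>2 * ?p n" for n
      by (simp add: cinner_scaleC_right norm_mult power_mult_distrib)
    have sx: "summable ?x" and lo: "A * (norm h)\<^sup>2 \<le> suminf ?x" and up: "suminf ?x \<le> B * (norm h)\<^sup>2"
      using X by (auto simp: frame_with_bounds_def)
    have ge: "a\<^sup>2 * ?p n \<le> ?x n" for n
      unfolding x using a am[of n] by (intro mult_right_mono power_mono) simp_all
    have le: "?x n \<le> b\<^sup>2 * ?p n" for n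
      unfolding x using bm[of n] by (intro mult_right_mono power_mono) simp_all
    have "summable (\<lambda>n. a\<^sup>2 * ?p n)"
      by (rule summable_comparison_test'[OF sx]) (use ge in simp)
    then show sp: "summable ?p"
      using a by (simp add: summable_cmult_iff)
    have "a\<^sup>2 * suminf ?p \<le> suminf ?x"
      using suminf_le[OF ge summable_mult[OF sp] sx] by (simp add: suminf_mult[OF sp])
    then have "a\<^sup>2 * suminf ?p \<le> B * (norm h)\<^sup>2"
      using up by simp
    then show "suminf ?p \<le> B / a\<^sup>2 * (norm h)\<^sup>2"
      using a by (simp add: field_simps)
    have "suminf ?x \<le> b\<^sup>2 * suminf ?p"
      using suminf_le[OF le sx summable_mult[OF sp]] by (simp add: suminf_mult[OF sp])
    then have "A * (norm h)\<^sup>2 \<le> b\<^sup>2 * suminf ?p"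
      using lo by simp
    then show "A / b\<^sup>2 * (norm h)\<^sup>2 \<le> suminf ?p"
      using \<open>b > 0\<close> by (simp add: field_simps)
  qed
  then show ?thesis by (auto simp: is_frame_def)
qed

theorem proposition4p9:
  fixes \<Phi> \<Psi> :: "nat \<Rightarrow> 'a::chilbert_space"
    and m :: "nat \<Rightarrow> complex"
    and A B \<mu> :: real
  assumes "separable_infinite_dim TYPE('a)"
    and "frame_with_bounds \<Phi> A B"
    and "\<forall>n. m n \<noteq> 0 \<and> \<Phi> n \<noteq> 0 \<and> \<Psi> n \<noteq> 0"
    and "0 \<le> \<mu>" and "\<mu> < A\<^sup>2 / B"
    and "\<forall>f. summable (\<lambda>n. (cmod (cinner f (m n *\<^sub>C \<Psi> n - \<Phi> n)))\<^sup>2) \<and>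
             (\<Sum>n. (cmod (cinner f (m n *\<^sub>C \<Psi> n - \<Phi> n)))\<^sup>2) \<le> \<mu> * (norm f)\<^sup>2"
  shows "is_frame (\<lambda>n. m n *\<^sub>C \<Psi> n) \<and>
    multiplier_invertible (\<lambda>n. cnj (m n)) \<Phi> \<Psi> \<and>
    multiplier_invertible m \<Psi> \<Phi> \<and>
    (\<forall>M \<in> {multiplier (\<lambda>n. cnj (m n)) \<Phi> \<Psi>, multiplier m \<Psi> \<Phi>}.
       (\<forall>h. 1 / (B + sqrt (\<mu> * B)) * norm h \<le> norm (inv M h) \<and>
            norm (inv M h) \<le> 1 / (A - sqrt (\<mu> * B)) * norm h) \<and>
       op_norm_sums
         (\<lambda>k. ((\<lambda>f. inv (frame_operator \<Phi>) (frame_operator \<Phi> f - M f)) ^^ k)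
                 \<circ> inv (frame_operator \<Phi>))
         (inv M)) \<and>
    (semi_normalized m \<longrightarrow> is_frame \<Psi>)"
proof -
  define X where "X n = m n *\<^sub>C \<Psi> n" for n
  define D where "D n = m n *\<^sub>C \<Psi> n - \<Phi> n" for n
  define c where "c = sqrt (\<mu> * B)"
  note \<Phi> = assms(2)
  \<comment> \<open>Infinite dimension enters here, through the existence of a nonzero
    vector.\<close>
  have "A \<le> B"
    using nontrivial_if_separable_infinite_dim[OF assms(1)] frame_bounds_le[OF \<Phi>] by blast
  have "A > 0" using \<Phi> by (simp add: frame_with_bounds_def)
  then have "B > 0" using \<open>A \<le> B\<close> by simp
  note bes_\<Phi> = frame_operator_bounds_surj(1)[OF \<Phi> \<open>A \<le> B\<close>]
  have bes_D: "bessel D \<mu>"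
    using assms(4,6) by (simp add: bessel_def D_def)
  have X_eq: "X = (\<lambda>n. \<Phi> n + D n)"
    by (simp add: fun_eq_iff X_def D_def)
  have bes_X: "bessel X (2 * B + 2 * \<mu>)"
    unfolding X_eq by (rule bessel_add[OF bes_\<Phi> bes_D])
  have "c \<ge> 0" using assms(4) \<open>B > 0\<close> by (simp add: c_def)
  have "\<mu> * B < A\<^sup>2"
    using assms(5) \<open>B > 0\<close> by (simp add: field_simps)
  then have "c < A"
    using \<open>A > 0\<close> by (simp add: c_def real_less_lsqrt)
  \<comment> \<open>The second slot of \<open>cinner\<close> is conjugate-linear, so
    \<open>cnj (m n)\<close> moves into it as \<open>m n\<close>. In \<open>term2\<close> the factor
    joins the synthesised vector instead, and no conjugate appears.\<close>
  have term1: "cnj (m n) *\<^sub>C cinner f (\<Psi> n) *\<^sub>C \<Phi> n = cinner f (X n) *\<^sub>C \<Phi> n" for f n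
    by (simp add: X_def cinner_scaleC_right scaleC_scaleC)
  have term2: "m n *\<^sub>C cinner f (\<Phi> n) *\<^sub>C \<Psi> n = cinner f (\<Phi> n) *\<^sub>C X n" for f n
    by (simp add: X_def scaleC_scaleC mult.commute)
  have M1: "multiplier (\<lambda>n. cnj (m n)) \<Phi> \<Psi> = cross X \<Phi>"
    by (simp add: fun_eq_iff multiplier_def cross_def term1)
  have M2: "multiplier m \<Psi> \<Phi> = cross \<Phi> X"
    by (simp add: fun_eq_iff multiplier_def cross_def term2)
  have S: "frame_operator \<Phi> = cross \<Phi> \<Phi>"
    by (simp add: fun_eq_iff frame_operator_def cross_def)
  \<comment> \<open>Here the analysis slot is perturbed, leaving \<open>cross D \<Phi>\<close>; for
    the other multiplier it is the synthesis slot, leaving \<open>cross \<Phi> D\<close>. Both have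
    norm at most \<open>sqrt (\<mu> * B)\<close>.\<close>
  have "cross X \<Phi> h = frame_operator \<Phi> h + cross D \<Phi> h" for h
    unfolding S cross_def X_eq
    by (subst suminf_add) (simp_all add: summable_cross[OF bes_\<Phi> bes_\<Phi>] summable_cross[OF bes_D bes_\<Phi>]
        cinner_add_right scaleC_add_left)
  then have close1: "norm (frame_operator \<Phi> h - cross X \<Phi> h) \<le> c * norm h" for h
    using norm_cross_le[OF bes_D bes_\<Phi>, of h] by (simp add: c_def)
  have "cross \<Phi> X h = frame_operator \<Phi> h + cross \<Phi> D h" for h
    unfolding S cross_def X_eq
    by (subst suminf_add) (simp_all add: summable_cross[OF bes_\<Phi> bes_\<Phi>] summable_cross[OF bes_\<Phi> bes_D]
        scaleC_add_right)
  then have close2: "norm (frame_operator \<Phi> h - cross \<Phi> X h) \<le> c * norm h" for h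
    using norm_cross_le[OF bes_\<Phi> bes_D, of h] by (simp add: c_def mult.commute)
  note P1 = frame_perturbation[OF \<Phi> \<open>A \<le> B\<close> bounded_clinear_cross[OF bes_X bes_\<Phi>] close1
      \<open>c \<ge> 0\<close> \<open>c < A\<close>]
  note P2 = frame_perturbation[OF \<Phi> \<open>A \<le> B\<close> bounded_clinear_cross[OF bes_\<Phi> bes_X] close2
      \<open>c \<ge> 0\<close> \<open>c < A\<close>]
  have inv1: "multiplier_invertible (\<lambda>n. cnj (m n)) \<Phi> \<Psi>"
    unfolding multiplier_invertible_def M1 term1
    using P1(1) summable_cross[OF bes_X bes_\<Phi>] by blast
  have inv2: "multiplier_invertible m \<Psi> \<Phi>"
    unfolding multiplier_invertible_def M2 term2
    using P2(1) summable_cross[OF bes_\<Phi> bes_X] by blast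
  \<comment> \<open>The operator \<open>cross X \<Phi>\<close> is bounded below by
    \<open>A - c\<close>, while its squared norm at \<open>h\<close> is at most \<open>B\<close>
    times the frame sum of \<open>X\<close>; dividing by \<open>B\<close> gives the lower frame
    bound.\<close>
  have "frame_with_bounds X ((A - c)\<^sup>2 / B) (2 * B + 2 * \<mu>)"
    unfolding frame_with_bounds_def
  proof (intro conjI allI)
    fix h
    have "(A - c) * norm h \<le> norm (cross X \<Phi> h)"
      using frame_operator_bounds_surj(4)[OF \<Phi> \<open>A \<le> B\<close>, of h] close1[of h]
        norm_triangle_sub[of "frame_operator \<Phi> h" "cross X \<Phi> h"]
      by (simp add: algebra_simps)
    then have "((A - c) * norm h)\<^sup>2 \<le> (norm (cross X \<Phi> h))\<^sup>2"
      using \<open>c < A\<close> by (intro power_mono) simp_all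
    also have "\<dots> \<le> B * (\<Sum>n. (cmod (cinner h (X n)))\<^sup>2)"
      by (rule norm_cross_sq_le[OF bes_X bes_\<Phi>])
    finally show "(A - c)\<^sup>2 / B * (norm h)\<^sup>2 \<le> (\<Sum>n. (cmod (cinner h (X n)))\<^sup>2)"
      using \<open>B > 0\<close> by (simp add: power_mult_distrib pos_divide_le_eq mult.commute)
  qed (use bes_X \<open>c < A\<close> \<open>B > 0\<close> in \<open>auto simp: bessel_def\<close>)
  then have frame: "is_frame (\<lambda>n. m n *\<^sub>C \<Psi> n)"
    unfolding X_def is_frame_def by blast
  show ?thesis
    using frame inv1 inv2 P1(2) P2(2) is_frame_unscale[OF frame]
    unfolding M1[symmetric] M2[symmetric] c_def by blast
qed

end
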